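(* Let $P$ be a probability measure on a measurable space $\mathcal{X}$, let $B>0$, $\sigma>0$, $n\ge1$, and let $\mathcal{F}$ be a nonempty class of measurable functions $f:\mathcal{X}\to[-B,B]$. For $f\in\mathcal{F}$ let $X_1,X_2,\dots$ be i.i.d. with distribution $P$ and $Y_i=f(X_i)+\epsilon_i$, where the $\epsilon_i$ are i.i.d. Normal$(0,\sigma^2)$ independent of the $X_i$. For each $m=0,1,\dots,n$ let $\hat f_m$ be an estimator based on $((X_i,Y_i):i=1,\dots,m)$, and let $r_m(\mathcal{F})<\infty$ be an upper bound on $\sup_{f\in\mathcal{F}}E[\|f-\hat f_m\|^2]$, where $\|\cdot\|$ is the $L_2(P)$ norm. Let $r_n^*(\mathcal{F})$ be defined by $n\,r_n^*(\mathcal{F})=\sum_{m=0}^{n-1}r_m(\mathcal{F})$. Then for all $\epsilon>0$ (with $N(\epsilon,\mathcal{F})\ge2$), $$r_n(\mathcal{F})\ge\frac{\epsilon^2}{4}\left(1-\frac{n\,r_n^*(\mathcal{F})/(2\sigma^2)+\log2}{\log N(\epsilon,\mathcal{F})}\right).$$ In particular, for $\epsilon^2\ge8r_n(\mathcal{F})$ (and $\epsilon>0$), $$\log N(\epsilon,\mathcal{F})\le n\,r_n^*(\mathcal{F})/\sigma^2+2\log2.$$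
   Context: $N(\epsilon,\mathcal{F})$ is the size of a maximal $\epsilon$-packing of $\mathcal{F}$ with respect to the $L_2(P)$ distance, i.e. the largest size of a subset of $\mathcal{F}$ whose distinct members are at $L_2(P)$ distance greater than $\epsilon$. An estimator $\hat f_m$ is a (jointly measurable) real function on $\mathcal{X}$ depending on the data $(X_i,Y_i)_{i\le m}$; $\hat f_0$ uses no data. Logarithms are natural. *)

theory Defs
  imports "HOL-Probability.Probability"
begin

text \<open>
  The squared norm is \<^typ>\<open>ennreal\<close>-valued because an estimator need not be square
  integrable: a lack of integrability must give an infinite risk, not the value \<open>0\<close> of a
  non-existing Bochner integral.
\<close>

definition L2_norm_sq :: "'a measure \<Rightarrow> ('a \<Rightarrow> real) \<Rightarrow> ennreal" where
  "L2_norm_sq P g = (\<integral>\<^sup>+ x. ennreal ((g x)\<^sup>2) \<partial>P)"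

text \<open>Used only for bounded measurable functions, where the squared norm is finite.\<close>

definition L2_dist :: "'a measure \<Rightarrow> ('a \<Rightarrow> real) \<Rightarrow> ('a \<Rightarrow> real) \<Rightarrow> real" where
  "L2_dist P f g = sqrt (enn2real (L2_norm_sq P (\<lambda>x. f x - g x)))"

definition is_packing ::
    "'a measure \<Rightarrow> real \<Rightarrow> ('a \<Rightarrow> real) set \<Rightarrow> ('a \<Rightarrow> real) set \<Rightarrow> bool" where
  "is_packing P \<epsilon> \<F> S \<longleftrightarrow> S \<subseteq> \<F> \<and> (\<forall>f\<in>S. \<forall>g\<in>S. f \<noteq> g \<longrightarrow> L2_dist P f g > \<epsilon>)"

text \<open>Extended-valued, since the class is not assumed to be totally bounded.\<close>

definition packing_number :: "'a measure \<Rightarrow> real \<Rightarrow> ('a \<Rightarrow> real) set \<Rightarrow> enat" where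
  "packing_number P \<epsilon> \<F> =
     (SUP S \<in> {S. is_packing P \<epsilon> \<F> S}. if finite S then enat (card S) else \<infinity>)"

text \<open>Only applied to arguments \<open>\<ge> 1\<close>; the value at \<open>0\<close> is irrelevant.\<close>

definition ln_enat :: "enat \<Rightarrow> ereal" where
  "ln_enat N = (case N of enat k \<Rightarrow> ereal (ln (real k)) | \<infinity> \<Rightarrow> \<infinity>)"

text \<open>The data live in the product space over the index set \<open>{1..m}\<close>, a single point for \<open>m = 0\<close>.\<close>

abbreviation data_space :: "'a measure \<Rightarrow> nat \<Rightarrow> (nat \<Rightarrow> 'a \<times> real) measure" where
  "data_space P m \<equiv> PiM {1..m} (\<lambda>_. P \<Otimes>\<^sub>M borel)"

definition regression_data ::
    "(nat \<Rightarrow> 'w \<Rightarrow> 'a) \<Rightarrow> (nat \<Rightarrow> 'w \<Rightarrow> real) \<Rightarrow> ('a \<Rightarrow> real) \<Rightarrow> nat \<Rightarrow> 'w \<Rightarrow> (nat \<Rightarrow> 'a \<times> real)" where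
  "regression_data X e f m \<omega> = (\<lambda>i\<in>{1..m}. (X i \<omega>, f (X i \<omega>) + e i \<omega>))"

definition is_estimator ::
    "'a measure \<Rightarrow> nat \<Rightarrow> ((nat \<Rightarrow> 'a \<times> real) \<Rightarrow> 'a \<Rightarrow> real) \<Rightarrow> bool" where
  "is_estimator P m h \<longleftrightarrow> (\<lambda>(d, x). h d x) \<in> borel_measurable (data_space P m \<Otimes>\<^sub>M P)"

definition risk ::
    "'w measure \<Rightarrow> 'a measure \<Rightarrow> (nat \<Rightarrow> 'w \<Rightarrow> 'a) \<Rightarrow> (nat \<Rightarrow> 'w \<Rightarrow> real) \<Rightarrow> nat \<Rightarrow>
     ((nat \<Rightarrow> 'a \<times> real) \<Rightarrow> 'a \<Rightarrow> real) \<Rightarrow> ('a \<Rightarrow> real) \<Rightarrow> ennreal" where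
  "risk \<Omega> P X e m h f =
     (\<integral>\<^sup>+ \<omega>. L2_norm_sq P (\<lambda>x. f x - h (regression_data X e f m \<omega>) x) \<partial>\<Omega>)"

text \<open>
  Independence of two random elements of possibly different types; the library's
  \<^const>\<open>prob_space.indep_var\<close> requires a common codomain type.
\<close>

definition indep_pair ::
    "'w measure \<Rightarrow> 'b measure \<Rightarrow> ('w \<Rightarrow> 'b) \<Rightarrow> 'c measure \<Rightarrow> ('w \<Rightarrow> 'c) \<Rightarrow> bool" where
  "indep_pair \<Omega> M U N V \<longleftrightarrow>
     U \<in> measurable \<Omega> M \<and> V \<in> measurable \<Omega> N \<and>
     prob_space.indep_set \<Omega>
       {U -` A \<inter> space \<Omega> | A. A \<in> sets M} {V -` A \<inter> space \<Omega> | A. A \<in> sets N}"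

text \<open>
  The design points are i.i.d. with law \<open>P\<close>, the errors are i.i.d. centred normal with standard
  deviation \<open>\<sigma>\<close>, and the two sequences are independent of each other.
\<close>

definition regression_model ::
    "'w measure \<Rightarrow> 'a measure \<Rightarrow> real \<Rightarrow> (nat \<Rightarrow> 'w \<Rightarrow> 'a) \<Rightarrow> (nat \<Rightarrow> 'w \<Rightarrow> real) \<Rightarrow> bool" where
  "regression_model \<Omega> P \<sigma> X e \<longleftrightarrow>
     prob_space \<Omega> \<and>
     prob_space.indep_vars \<Omega> (\<lambda>_. P) X {1..} \<and>
     (\<forall>i\<ge>1. distr \<Omega> P (X i) = P) \<and>
     prob_space.indep_vars \<Omega> (\<lambda>_. borel) e {1..} \<and>
     (\<forall>i\<ge>1. distributed \<Omega> lborel (e i) (\<lambda>z. ennreal (normal_density 0 \<sigma> z))) \<and>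
     indep_pair \<Omega>
       (PiM {1..} (\<lambda>_. P)) (\<lambda>\<omega>. \<lambda>i\<in>{1..}. X i \<omega>)
       (PiM {1..} (\<lambda>_. borel)) (\<lambda>\<omega>. \<lambda>i\<in>{1..}. e i \<omega>)"

end

theory Submission
  imports Defs
begin

text \<open>
  Put the uniform prior on a finite packing \<open>S\<close> of size \<open>a\<close>. The estimators define a single
  sequential predictive density \<open>q(z) = (\<Prod>i<n. \<phi>(y\<^bsub>i+1\<^esub> - h\<^sub>i(z\<^sub>1,\<dots>,z\<^sub>i)(x\<^bsub>i+1\<^esub>)))\<close>, with
  \<open>\<phi>\<close> the noise density, and by the chain rule the Kullback--Leibler divergence of the data law
  \<open>p\<^sub>f\<close> from \<open>q\<close> is the cumulative risk divided by \<open>2\<sigma>\<^sup>2\<close>. On the other hand the events \<open>A\<^sub>f\<close>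
  that the estimate after \<open>n\<close> observations is within \<open>\<epsilon>/2\<close> of \<open>f\<close> are disjoint for \<open>f \<in> S\<close>, so
  their \<open>q\<close>-probabilities add up to at most \<open>1\<close>, while \<open>p\<^sub>f(A\<^sub>f) \<ge> 1 - 4 r\<^sub>n / \<epsilon>\<^sup>2\<close> by Markov's
  inequality. Fano's inequality in the form needed here follows by averaging \<open>t \<le> exp t - 1\<close>
  over \<open>f \<in> S\<close> and \<open>p\<^sub>f\<close>, at \<open>t = ln a \<cdot> 1\<^bsub>A f\<^esub> + ln (q / p\<^sub>f) - ln 2\<close>. If the packing number is
  infinite, let \<open>a\<close> tend to infinity.
\<close>

section \<open>Law of one observation and of a finite sample\<close>

lemma emeasure_distr_nn_integral:
  assumes "h \<in> M \<rightarrow>\<^sub>M S" and "A \<in> sets S"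
  shows "emeasure (distr M S h) A = (\<integral>\<^sup>+ p. indicator A (h p) \<partial>M)"
  using assms nn_integral_distr[of h M S "indicator A"] by simp

locale gaussian_regression = prob_space P for P :: "'a measure" +
  fixes \<sigma> :: real
  assumes sigma_pos: "\<sigma> > 0"
begin

abbreviation N :: "real measure" where "N \<equiv> density lborel (normal_density 0 \<sigma>)"

text \<open>The joint law of a design point and its response when the regression function is
  \<open>f\<close>. The dominating measure does not involve \<open>f\<close>, so likelihood ratios
  can be formed without further work.\<close>

definition obs :: "('a \<Rightarrow> real) \<Rightarrow> ('a \<times> real) measure" where
  "obs f = density (P \<Otimes>\<^sub>M lborel) (\<lambda>(x, y). ennreal (normal_density (f x) \<sigma> y))"

lemma prob_space_N: "prob_space N"
  using sigma_pos by (rule prob_space_normal_density)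

lemma sets_obs [measurable_cong, simp]: "sets (obs f) = sets (P \<Otimes>\<^sub>M borel)"
  unfolding obs_def sets_density by (intro sets_pair_measure_cong) simp_all

lemma space_obs [simp]: "space (obs f) = space P \<times> UNIV"
  by (simp add: obs_def space_pair_measure)

lemma sets_PiM_obs [measurable_cong, simp]: "sets (PiM I (\<lambda>_. obs f)) = sets (PiM I (\<lambda>_. P \<Otimes>\<^sub>M borel))"
  by (intro sets_PiM_cong) simp_all

lemma space_PiM_obs [simp]: "space (PiM I (\<lambda>_. obs f)) = space (PiM I (\<lambda>_. P \<Otimes>\<^sub>M borel))"
  by (rule sets_eq_imp_space_eq) (rule sets_PiM_obs)

lemma normal_density_shift: "normal_density \<mu> \<sigma> (\<mu> + z) = normal_density 0 \<sigma> z"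
  by (simp add: normal_density_def)

lemma measurable_normal_density2 [measurable (raw)]:
  assumes [measurable]: "g \<in> borel_measurable M" "h \<in> borel_measurable M"
  shows "(\<lambda>x. normal_density (g x) s (h x)) \<in> borel_measurable M"
  unfolding normal_density_def by measurable

text \<open>Tonelli and the shift \<open>y = f x + z\<close>, under which Lebesgue measure is
  invariant, turn the density form of \<open>obs\<close> into the signal-plus-noise form. The first
  suits likelihood ratios, the second matches the model.\<close>

lemma nn_integral_obs:
  assumes [measurable]: "f \<in> borel_measurable P" "u \<in> borel_measurable (P \<Otimes>\<^sub>M borel)"
  shows "(\<integral>\<^sup>+ w. u w \<partial>obs f) = (\<integral>\<^sup>+ x. \<integral>\<^sup>+ z. u (x, f x + z) \<partial>N \<partial>P)"
proof -
  have "(\<integral>\<^sup>+ w. u w \<partial>obs f) =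
      (\<integral>\<^sup>+ w. ennreal (normal_density (f (fst w)) \<sigma> (snd w)) * u w \<partial>(P \<Otimes>\<^sub>M lborel))"
    unfolding obs_def by (subst nn_integral_density) (auto simp: split_beta')
  also have "\<dots> = (\<integral>\<^sup>+ x. \<integral>\<^sup>+ y. ennreal (normal_density (f x) \<sigma> y) * u (x, y) \<partial>lborel \<partial>P)"
    by (subst lborel.nn_integral_fst[symmetric]) auto
  also have "\<dots> = (\<integral>\<^sup>+ x. \<integral>\<^sup>+ z. u (x, f x + z) \<partial>N \<partial>P)"
  proof (intro nn_integral_cong)
    fix x assume [measurable]: "x \<in> space P"
    have "(\<integral>\<^sup>+ y. ennreal (normal_density (f x) \<sigma> y) * u (x, y) \<partial>lborel) =
        (\<integral>\<^sup>+ z. ennreal (normal_density (f x) \<sigma> (f x + z)) * u (x, f x + z) \<partial>lborel)"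
      by (subst nn_integral_real_affine[where c=1 and t="f x"]) auto
    then show "(\<integral>\<^sup>+ y. ennreal (normal_density (f x) \<sigma> y) * u (x, y) \<partial>lborel) =
        (\<integral>\<^sup>+ z. u (x, f x + z) \<partial>N)"
      by (subst nn_integral_density) (auto simp: normal_density_shift)
  qed
  finally show ?thesis .
qed

lemma prob_space_obs:
  assumes "f \<in> borel_measurable P"
  shows "prob_space (obs f)"
proof
  interpret N: prob_space N by (rule prob_space_N)
  show "emeasure (obs f) (space (obs f)) = 1"
    using nn_integral_obs[OF assms, of "\<lambda>_. 1"] N.emeasure_space_1 emeasure_space_1
    by (simp del: space_obs)
qed

lemma product_prob_space_obs:
  assumes "f \<in> borel_measurable P"
  shows "product_prob_space (\<lambda>_. obs f)"
proof -
  interpret O: prob_space "obs f" using assms by (rule prob_space_obs)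
  show ?thesis by unfold_locales
qed

text \<open>The one-step decomposition for inductions on the sample size: the past \<open>d\<close>,
  the new design point \<open>x\<close> and the new noise \<open>z\<close> are independent, so terms
  linear in \<open>z\<close> will average out.\<close>

lemma PiM_obs_Suc:
  assumes f [measurable]: "f \<in> borel_measurable P"
  shows "PiM {1..Suc m} (\<lambda>_. obs f) =
    distr ((PiM {1..m} (\<lambda>_. obs f) \<Otimes>\<^sub>M P) \<Otimes>\<^sub>M N) (data_space P (Suc m))
      (\<lambda>((d, x), z). d(Suc m := (x, f x + z)))" (is "?L = distr ?M ?S ?h")
proof -
  interpret O: product_prob_space "\<lambda>_. obs f" using f by (rule product_prob_space_obs)
  interpret N: prob_space N by (rule prob_space_N)
  interpret D: prob_space "PiM {1..m} (\<lambda>_. obs f)"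
    by (intro prob_space_PiM prob_space_obs f)
  have eq: "{1..Suc m} = insert (Suc m) {1..m}" by auto
  have h [measurable]: "?h \<in> ?M \<rightarrow>\<^sub>M ?S"
    unfolding split_beta' eq by (rule measurable_fun_upd[where J="{1..m}"]) auto
  show ?thesis
  proof (rule measure_eqI)
    fix A assume "A \<in> sets ?L"
    then have A [measurable]: "A \<in> sets ?S" by simp
    have "emeasure ?L A = (\<integral>\<^sup>+ d. indicator A d \<partial>?L)"
      using A by (subst nn_integral_indicator) auto
    also have "\<dots> = (\<integral>\<^sup>+ d. \<integral>\<^sup>+ w. indicator A (d(Suc m := w)) \<partial>obs f \<partial>PiM {1..m} (\<lambda>_. obs f))"
      unfolding eq using A[unfolded eq] by (subst O.product_nn_integral_insert) auto
    also have "\<dots> = (\<integral>\<^sup>+ d. \<integral>\<^sup>+ x. \<integral>\<^sup>+ z. indicator A (d(Suc m := (x, f x + z))) \<partial>N \<partial>P \<partial>PiM {1..m} (\<lambda>_. obs f))"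
    proof (intro nn_integral_cong nn_integral_obs f)
      fix d assume d: "d \<in> space (PiM {1..m} (\<lambda>_. obs f))"
      then have "(\<lambda>w. d(Suc m := w)) \<in> P \<Otimes>\<^sub>M borel \<rightarrow>\<^sub>M PiM (insert (Suc m) {1..m}) (\<lambda>_. P \<Otimes>\<^sub>M borel)"
        by (intro measurable_component_update) auto
      then show "(\<lambda>w. indicator A (d(Suc m := w)) :: ennreal) \<in> borel_measurable (P \<Otimes>\<^sub>M borel)"
        using A[unfolded eq] by measurable
    qed
    also have "\<dots> = (\<integral>\<^sup>+ d. \<integral>\<^sup>+ x. \<integral>\<^sup>+ z. indicator A (?h ((d, x), z)) \<partial>N \<partial>P \<partial>PiM {1..m} (\<lambda>_. obs f))"
      by simp
    also have "\<dots> = (\<integral>\<^sup>+ p. indicator A (?h p) \<partial>?M)"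
      by (subst nn_integral_fst, measurable, subst N.nn_integral_fst, measurable)
    also have "\<dots> = emeasure (distr ?M ?S ?h) A"
      by (rule emeasure_distr_nn_integral[symmetric]) measurable
    finally show "emeasure ?L A = emeasure (distr ?M ?S ?h) A" .
  qed simp
qed

lemma emeasure_obs:
  assumes [measurable]: "f \<in> borel_measurable P" "A \<in> sets (P \<Otimes>\<^sub>M borel)"
  shows "emeasure (obs f) A = (\<integral>\<^sup>+ x. \<integral>\<^sup>+ z. indicator A (x, f x + z) \<partial>N \<partial>P)"
  using nn_integral_obs[OF assms(1), of "indicator A"] by simp

text \<open>Finite product laws are determined by boxes. On a box the indicator is a product over
  coordinates, and integrating first over the noise and then over the design keeps it a
  product.\<close>

lemma distr_PiM_noise:
  assumes f [measurable]: "f \<in> borel_measurable P" and I: "finite I"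
  shows "distr (PiM I (\<lambda>_. P) \<Otimes>\<^sub>M PiM I (\<lambda>_. N)) (PiM I (\<lambda>_. P \<Otimes>\<^sub>M borel))
      (\<lambda>(\<xi>, \<eta>). \<lambda>i\<in>I. (\<xi> i, f (\<xi> i) + \<eta> i)) = PiM I (\<lambda>_. obs f)"
    (is "distr ?M ?S ?h = _")
proof -
  interpret O: product_prob_space "\<lambda>_. obs f" using f by (rule product_prob_space_obs)
  interpret N: prob_space N by (rule prob_space_N)
  interpret NI: prob_space "PiM I (\<lambda>_. N)" by (intro prob_space_PiM prob_space_N)
  interpret NN: product_prob_space "\<lambda>_. N" by unfold_locales
  interpret PP: product_prob_space "\<lambda>_. P" by unfold_locales
  have h [measurable]: "?h \<in> ?M \<rightarrow>\<^sub>M ?S"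
    unfolding split_beta' by (intro measurable_restrict) measurable
  show ?thesis
  proof (rule O.PiM_eqI[OF I])
    fix A assume "\<And>i. i \<in> I \<Longrightarrow> A i \<in> sets (obs f)"
    then have A [measurable]: "i \<in> I \<Longrightarrow> A i \<in> sets (P \<Otimes>\<^sub>M borel)" for i by simp
    have box [measurable]: "Pi\<^sub>E I A \<in> sets ?S" using I A by (intro sets_PiM_I_finite) auto
    have "emeasure (distr ?M ?S ?h) (Pi\<^sub>E I A) = (\<integral>\<^sup>+ p. indicator (Pi\<^sub>E I A) (?h p) \<partial>?M)"
      by (rule emeasure_distr_nn_integral) measurable
    also have "\<dots> = (\<integral>\<^sup>+ \<xi>. \<integral>\<^sup>+ \<eta>. indicator (Pi\<^sub>E I A) (?h (\<xi>, \<eta>)) \<partial>PiM I (\<lambda>_. N) \<partial>PiM I (\<lambda>_. P))"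
      by (subst NI.nn_integral_fst) auto
    also have "\<dots> = (\<integral>\<^sup>+ \<xi>. \<integral>\<^sup>+ \<eta>. (\<Prod>i\<in>I. indicator (A i) (\<xi> i, f (\<xi> i) + \<eta> i)) \<partial>PiM I (\<lambda>_. N) \<partial>PiM I (\<lambda>_. P))"
      by (intro nn_integral_cong) (auto simp: indicator_def PiE_iff prod.If_cases I Int_def intro!: prod_zero[symmetric])
    also have "\<dots> = (\<integral>\<^sup>+ \<xi>. (\<Prod>i\<in>I. \<integral>\<^sup>+ z. indicator (A i) (\<xi> i, f (\<xi> i) + z) \<partial>N) \<partial>PiM I (\<lambda>_. P))"
    proof (rule nn_integral_cong, rule NN.product_nn_integral_prod[OF I])
      fix \<xi> i assume \<xi>: "\<xi> \<in> space (PiM I (\<lambda>_. P))" and i: "i \<in> I"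
      then have "\<xi> i \<in> space P" by (auto simp: space_PiM)
      then show "(\<lambda>z. indicator (A i) (\<xi> i, f (\<xi> i) + z)) \<in> borel_measurable N"
        using i by measurable
    qed
    also have "\<dots> = (\<Prod>i\<in>I. \<integral>\<^sup>+ x. \<integral>\<^sup>+ z. indicator (A i) (x, f x + z) \<partial>N \<partial>P)"
      by (rule PP.product_nn_integral_prod[OF I]) measurable
    also have "\<dots> = (\<Prod>i\<in>I. emeasure (obs f) (A i))"
      by (intro prod.cong refl emeasure_obs[symmetric] f A)
    finally show "emeasure (distr ?M ?S ?h) (Pi\<^sub>E I A) = (\<Prod>i\<in>I. emeasure (obs f) (A i))" .
  qed simp
qed

end

section \<open>Law of the data in the regression model\<close>

text \<open>Independence is exactly the product formula on rectangles, and rectangles determine the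
  product measure.\<close>

lemma indep_pair_distr:
  assumes "prob_space \<Omega>" and "indep_pair \<Omega> M U L V"
  shows "distr \<Omega> (M \<Otimes>\<^sub>M L) (\<lambda>\<omega>. (U \<omega>, V \<omega>)) = distr \<Omega> M U \<Otimes>\<^sub>M distr \<Omega> L V"
proof -
  interpret prob_space \<Omega> by fact
  from assms(2) have [measurable]: "U \<in> \<Omega> \<rightarrow>\<^sub>M M" "V \<in> \<Omega> \<rightarrow>\<^sub>M L" and
    ind: "indep_set {U -` A \<inter> space \<Omega> | A. A \<in> sets M} {V -` A \<inter> space \<Omega> | A. A \<in> sets L}"
    by (auto simp: indep_pair_def)
  show ?thesis
  proof (rule pair_measure_eqI[symmetric])
    fix A B assume "A \<in> sets (distr \<Omega> M U)" "B \<in> sets (distr \<Omega> L V)"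
    then have [measurable]: "A \<in> sets M" "B \<in> sets L" by auto
    have "prob ((U -` A \<inter> space \<Omega>) \<inter> (V -` B \<inter> space \<Omega>)) =
        prob (U -` A \<inter> space \<Omega>) * prob (V -` B \<inter> space \<Omega>)"
      by (rule indep_setD[OF ind]) auto
    moreover have "(U -` A \<inter> space \<Omega>) \<inter> (V -` B \<inter> space \<Omega>) =
        (\<lambda>\<omega>. (U \<omega>, V \<omega>)) -` (A \<times> B) \<inter> space \<Omega>" by auto
    ultimately show "emeasure (distr \<Omega> M U) A * emeasure (distr \<Omega> L V) B =
        emeasure (distr \<Omega> (M \<Otimes>\<^sub>M L) (\<lambda>\<omega>. (U \<omega>, V \<omega>))) (A \<times> B)"
      by (simp add: emeasure_distr emeasure_eq_measure ennreal_mult)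
  qed (auto intro!: prob_space_imp_sigma_finite prob_space_distr)
qed

text \<open>The joint law of an i.i.d. sequence is the infinite product, whose finite marginals are
  finite products. \<open>M\<close> and \<open>L\<close> are kept apart because for the errors the
  target space is \<open>borel\<close> while the law is \<open>N\<close>.\<close>

lemma distr_restrict_indep:
  assumes "prob_space \<Omega>" and "prob_space.indep_vars \<Omega> (\<lambda>_. M) X {1::nat..}"
    and "\<And>i. i \<ge> 1 \<Longrightarrow> distr \<Omega> M (X i) = L" and "sets L = sets M"
  shows "distr (distr \<Omega> (PiM {1..} (\<lambda>_. M)) (\<lambda>\<omega>. \<lambda>i\<in>{1..}. X i \<omega>)) (PiM {1..m} (\<lambda>_. L))
      (\<lambda>\<xi>. restrict \<xi> {1..m}) = PiM {1..m} (\<lambda>_. L)"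
proof -
  interpret prob_space \<Omega> by fact
  have rv: "X i \<in> \<Omega> \<rightarrow>\<^sub>M M" if "i \<ge> 1" for i
    using assms(2) that by (auto simp: indep_vars_def)
  interpret L: prob_space L using assms(3)[of 1] rv[of 1] prob_space_distr by auto
  interpret LL: product_prob_space "\<lambda>_. L" "{1::nat..}" by unfold_locales
  have "distr \<Omega> (PiM {1..} (\<lambda>_. M)) (\<lambda>\<omega>. \<lambda>i\<in>{1..}. X i \<omega>) = PiM {1..} (\<lambda>i. distr \<Omega> M (X i))"
    using assms(2) rv by (subst indep_vars_iff_distr_eq_PiM'[symmetric]) auto
  also have "\<dots> = PiM {1..} (\<lambda>_. L)"
    using assms(3) by (intro PiM_cong) auto
  finally show ?thesis
    using LL.distr_PiM_restrict_finite[of "{1..m}"] by simp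
qed

text \<open>The data are a function of the two full sequences: cut both to \<open>{1..m}\<close>,
  then combine them coordinatewise. Pushing the product law of the pair through these two maps gives
  the sample law, so that risks can be computed without reference to
  \<open>\<Omega>\<close>.\<close>

lemma (in gaussian_regression) distr_regression_data:
  assumes model: "regression_model \<Omega> P \<sigma> X e" and f [measurable]: "f \<in> borel_measurable P"
  shows "distr \<Omega> (data_space P m) (regression_data X e f m) = PiM {1..m} (\<lambda>_. obs f)"
    and "regression_data X e f m \<in> \<Omega> \<rightarrow>\<^sub>M data_space P m"
proof -
  interpret W: prob_space \<Omega> using model by (simp add: regression_model_def)
  interpret N: prob_space N by (rule prob_space_N)
  let ?X = "\<lambda>\<omega>. \<lambda>i\<in>{1..}. X i \<omega>" and ?e = "\<lambda>\<omega>. \<lambda>i\<in>{1..}. e i \<omega>"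
  let ?SX = "PiM {1..} (\<lambda>_::nat. P)" and ?SE = "PiM {1..} (\<lambda>_::nat. borel :: real measure)"
  let ?P = "PiM {1..m} (\<lambda>_. P)" and ?N = "PiM {1..m} (\<lambda>_. N)"
  have ind: "indep_pair \<Omega> ?SX ?X ?SE ?e"
    using model by (simp add: regression_model_def)
  have [measurable]: "?X \<in> \<Omega> \<rightarrow>\<^sub>M ?SX" "?e \<in> \<Omega> \<rightarrow>\<^sub>M ?SE"
    using ind by (auto simp: indep_pair_def)
  have e: "distr \<Omega> borel (e i) = N" if "i \<ge> 1" for i
  proof -
    have "distributed \<Omega> lborel (e i) (\<lambda>z. ennreal (normal_density 0 \<sigma> z))"
      using model that by (auto simp: regression_model_def)
    then have "distr \<Omega> lborel (e i) = N" by (auto simp: distributed_def)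
    moreover have "distr \<Omega> lborel (e i) = distr \<Omega> borel (e i)" by (rule distr_cong) auto
    ultimately show ?thesis by simp
  qed
  have rX: "(\<lambda>\<xi>. restrict \<xi> {1..m}) \<in> ?SX \<rightarrow>\<^sub>M ?P"
    by (rule measurable_restrict_subset) auto
  have sN: "sets ?N = sets (PiM {1..m} (\<lambda>_. borel))" by (intro sets_PiM_cong) auto
  have rE: "(\<lambda>\<xi>. restrict \<xi> {1..m}) \<in> ?SE \<rightarrow>\<^sub>M ?N"
    by (subst measurable_cong_sets[OF refl sN]) (rule measurable_restrict_subset, auto)
  note [measurable] = rX rE
  let ?r = "\<lambda>(\<xi>, \<eta>). (restrict \<xi> {1..m}, restrict \<eta> {1..m})"
  let ?h = "\<lambda>(\<xi>, \<eta>). \<lambda>i\<in>{1..m}. (\<xi> i, f (\<xi> i) + \<eta> i)"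
  have h [measurable]: "?h \<in> ?P \<Otimes>\<^sub>M ?N \<rightarrow>\<^sub>M data_space P m"
    unfolding split_beta' by (intro measurable_restrict) measurable
  have r [measurable]: "?r \<in> ?SX \<Otimes>\<^sub>M ?SE \<rightarrow>\<^sub>M ?P \<Otimes>\<^sub>M ?N"
    by measurable
  have data: "regression_data X e f m = (\<lambda>\<omega>. ?h (?r (?X \<omega>, ?e \<omega>)))"
    by (auto simp: regression_data_def fun_eq_iff)
  show "regression_data X e f m \<in> \<Omega> \<rightarrow>\<^sub>M data_space P m"
    unfolding data by measurable
  have "distr \<Omega> (data_space P m) (regression_data X e f m) =
      distr (distr (distr \<Omega> (?SX \<Otimes>\<^sub>M ?SE) (\<lambda>\<omega>. (?X \<omega>, ?e \<omega>))) (?P \<Otimes>\<^sub>M ?N) ?r) (data_space P m) ?h"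
    unfolding data by (subst distr_distr, measurable)+ (simp add: comp_def)
  also have "distr \<Omega> (?SX \<Otimes>\<^sub>M ?SE) (\<lambda>\<omega>. (?X \<omega>, ?e \<omega>)) = distr \<Omega> ?SX ?X \<Otimes>\<^sub>M distr \<Omega> ?SE ?e"
    by (rule indep_pair_distr[OF W.prob_space_axioms ind])
  also have "distr \<dots> (?P \<Otimes>\<^sub>M ?N) ?r =
      distr (distr \<Omega> ?SX ?X) ?P (\<lambda>\<xi>. restrict \<xi> {1..m}) \<Otimes>\<^sub>M distr (distr \<Omega> ?SE ?e) ?N (\<lambda>\<xi>. restrict \<xi> {1..m})"
  proof (rule pair_measure_distr[symmetric])
    interpret E: prob_space "distr \<Omega> ?SE ?e" by (rule W.prob_space_distr) measurable
    have "prob_space (distr (distr \<Omega> ?SE ?e) ?N (\<lambda>\<xi>. restrict \<xi> {1..m}))"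
      by (rule E.prob_space_distr) measurable
    then show "sigma_finite_measure (distr (distr \<Omega> ?SE ?e) ?N (\<lambda>\<xi>. restrict \<xi> {1..m}))"
      by (rule prob_space_imp_sigma_finite)
  qed measurable
  also have "distr (distr \<Omega> ?SX ?X) ?P (\<lambda>\<xi>. restrict \<xi> {1..m}) = ?P"
    using model by (intro distr_restrict_indep) (auto simp: regression_model_def)
  also have "distr (distr \<Omega> ?SE ?e) ?N (\<lambda>\<xi>. restrict \<xi> {1..m}) = ?N"
    using model e by (intro distr_restrict_indep) (auto simp: regression_model_def)
  also have "distr (?P \<Otimes>\<^sub>M ?N) (data_space P m) ?h = PiM {1..m} (\<lambda>_. obs f)"
    by (rule distr_PiM_noise[OF f]) simp
  finally show "distr \<Omega> (data_space P m) (regression_data X e f m) = PiM {1..m} (\<lambda>_. obs f)" .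
qed

section \<open>Predictive density and likelihood ratio\<close>

context gaussian_regression
begin

text \<open>A density against products of \<open>P\<close> and Lebesgue measure: the design keeps
  its true law, and only the unknown mean of each response is replaced by an estimate. The
  \<open>restrict\<close> hides the current and later observations from the data argument of
  \<open>h i\<close>.\<close>

definition pred_density :: "(nat \<Rightarrow> (nat \<Rightarrow> 'a \<times> real) \<Rightarrow> 'a \<Rightarrow> real) \<Rightarrow> nat \<Rightarrow> (nat \<Rightarrow> 'a \<times> real) \<Rightarrow> real" where
  "pred_density h m z =
    (\<Prod>i<m. normal_density (h i (restrict z {1..i}) (fst (z (Suc i)))) \<sigma> (snd (z (Suc i))))"

text \<open>
  The log-likelihood ratio \<open>ln (q / p\<^sub>f)\<close> of the predictive density to the true one. Observation
  \<open>Suc i\<close> is predicted by the estimator \<open>h i\<close> that uses the observations \<open>1, \<dots>, i\<close>.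
\<close>

definition llr :: "(nat \<Rightarrow> (nat \<Rightarrow> 'a \<times> real) \<Rightarrow> 'a \<Rightarrow> real) \<Rightarrow> ('a \<Rightarrow> real) \<Rightarrow> nat \<Rightarrow> (nat \<Rightarrow> 'a \<times> real) \<Rightarrow> real" where
  "llr h f m z =
    (\<Sum>i<m. ((snd (z (Suc i)) - f (fst (z (Suc i))))\<^sup>2 -
      (snd (z (Suc i)) - h i (restrict z {1..i}) (fst (z (Suc i))))\<^sup>2) / (2 * \<sigma>\<^sup>2))"

lemma measurable_estimate:
  assumes "is_estimator P i (h i)" "i < m"
  shows "(\<lambda>z. h i (restrict z {1..i}) (fst (z (Suc i)))) \<in> borel_measurable (data_space P m)"
proof -
  have [measurable]: "(\<lambda>z. restrict z {1..i}) \<in> data_space P m \<rightarrow>\<^sub>M data_space P i"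
    using assms by (intro measurable_restrict_subset) auto
  have [measurable]: "(\<lambda>z. z (Suc i)) \<in> data_space P m \<rightarrow>\<^sub>M P \<Otimes>\<^sub>M borel"
    using assms by (intro measurable_component_singleton) auto
  have [measurable]: "(\<lambda>(d, x). h i d x) \<in> borel_measurable (data_space P i \<Otimes>\<^sub>M P)"
    using assms by (simp add: is_estimator_def)
  have "(\<lambda>z. (\<lambda>(d, x). h i d x) (restrict z {1..i}, fst (z (Suc i)))) \<in> borel_measurable (data_space P m)"
    by measurable
  then show ?thesis by simp
qed

lemma measurable_observation:
  "i < m \<Longrightarrow> (\<lambda>z. z (Suc i)) \<in> data_space P m \<rightarrow>\<^sub>M P \<Otimes>\<^sub>M borel"
  by (intro measurable_component_singleton) auto

lemma measurable_pred_density [measurable]: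
  assumes "\<And>i. i < m \<Longrightarrow> is_estimator P i (h i)"
  shows "pred_density h m \<in> borel_measurable (data_space P m)"
proof -
  note [measurable] = measurable_estimate[OF assms] measurable_observation
  show ?thesis unfolding pred_density_def by measurable
qed

lemma measurable_llr [measurable]:
  assumes "\<And>i. i < m \<Longrightarrow> is_estimator P i (h i)" and [measurable]: "f \<in> borel_measurable P"
  shows "llr h f m \<in> borel_measurable (data_space P m)"
proof -
  note [measurable] = measurable_estimate[OF assms(1)] measurable_observation
  show ?thesis unfolding llr_def by measurable
qed

lemma sets_PiM_lborel [measurable_cong, simp]:
  "sets (PiM I (\<lambda>_. P \<Otimes>\<^sub>M lborel)) = sets (PiM I (\<lambda>_. P \<Otimes>\<^sub>M borel))"
  by (intro sets_PiM_cong sets_pair_measure_cong) simp_all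

lemma space_PiM_lborel [simp]:
  "space (PiM I (\<lambda>_. P \<Otimes>\<^sub>M lborel)) = space (PiM I (\<lambda>_. P \<Otimes>\<^sub>M borel))"
  by (rule sets_eq_imp_space_eq) (rule sets_PiM_lborel)

lemma product_sigma_finite_lborel: "product_sigma_finite (\<lambda>_. P \<Otimes>\<^sub>M (lborel :: real measure))"
proof -
  interpret PL: pair_sigma_finite P "lborel :: real measure" by unfold_locales
  show ?thesis by unfold_locales
qed

lemma PiM_obs_density:
  assumes f [measurable]: "f \<in> borel_measurable P"
  shows "PiM {1..m} (\<lambda>_. obs f) = density (PiM {1..m} (\<lambda>_. P \<Otimes>\<^sub>M lborel))
    (\<lambda>z. ennreal (\<Prod>i<m. normal_density (f (fst (z (Suc i)))) \<sigma> (snd (z (Suc i)))))"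
    (is "_ = density ?B ?p")
proof -
  interpret O: product_prob_space "\<lambda>_. obs f" using f by (rule product_prob_space_obs)
  interpret L: product_sigma_finite "\<lambda>_. P \<Otimes>\<^sub>M (lborel :: real measure)"
    by (rule product_sigma_finite_lborel)
  let ?d = "\<lambda>w. ennreal (normal_density (f (fst w)) \<sigma> (snd w))"
  have p: "?p z = (\<Prod>i\<in>{1..m}. ?d (z i))" for z
    by (simp add: prod.atLeast1_atMost_eq prod_ennreal)
  have "?p \<in> borel_measurable (data_space P m)"
  proof -
    note [measurable] = measurable_observation
    show ?thesis by measurable
  qed
  then have [measurable]: "?p \<in> borel_measurable ?B"
    by (subst measurable_cong_sets[OF sets_PiM_lborel refl])
  show ?thesis
  proof (rule O.PiM_eqI[symmetric])
    fix A assume "\<And>i. i \<in> {1..m} \<Longrightarrow> A i \<in> sets (obs f)"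
    then have A [measurable]: "i \<in> {1..m} \<Longrightarrow> A i \<in> sets (P \<Otimes>\<^sub>M borel)" for i by simp
    then have [measurable]: "i \<in> {1..m} \<Longrightarrow> A i \<in> sets (P \<Otimes>\<^sub>M lborel)" for i
      by (subst sets_pair_measure_cong[OF refl, of _ borel]) auto
    have box: "Pi\<^sub>E {1..m} A \<in> sets ?B"
      unfolding sets_PiM_lborel using A by (intro sets_PiM_I_finite) auto
    have "emeasure (density ?B ?p) (Pi\<^sub>E {1..m} A) =
        (\<integral>\<^sup>+ z. ?p z * indicator (Pi\<^sub>E {1..m} A) z \<partial>?B)"
      using box by (intro emeasure_density) measurable
    also have "\<dots> = (\<integral>\<^sup>+ z. (\<Prod>i\<in>{1..m}. ?d (z i) * indicator (A i) (z i)) \<partial>?B)"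
    proof (rule nn_integral_cong)
      \<comment> \<open>Membership in the space supplies extensionality; otherwise the indicator of
        the box could be \<open>0\<close> while all coordinate indicators are
        \<open>1\<close>.\<close>
      fix z assume "z \<in> space ?B"
      then have "z \<in> extensional {1..m}" by (auto simp: space_PiM PiE_def)
      then have "indicator (Pi\<^sub>E {1..m} A) z = (\<Prod>i\<in>{1..m}. indicator (A i) (z i) :: ennreal)"
        by (auto simp: indicator_def PiE_iff prod.If_cases Int_def intro!: prod_zero[symmetric])
      then show "?p z * indicator (Pi\<^sub>E {1..m} A) z = (\<Prod>i\<in>{1..m}. ?d (z i) * indicator (A i) (z i))"
        by (simp only: p prod.distrib)
    qed
    also have "\<dots> = (\<Prod>i\<in>{1..m}. \<integral>\<^sup>+ w. ?d w * indicator (A i) w \<partial>(P \<Otimes>\<^sub>M lborel))"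
      by (rule L.product_nn_integral_prod) measurable
    also have "\<dots> = (\<Prod>i\<in>{1..m}. emeasure (obs f) (A i))"
      unfolding obs_def by (intro prod.cong refl) (subst emeasure_density, auto simp: split_beta')
    finally show "emeasure (density ?B ?p) (Pi\<^sub>E {1..m} A) = (\<Prod>i\<in>{1..m}. emeasure (obs f) (A i))" .
  qed simp_all
qed

lemma pred_density_nonneg: "0 \<le> pred_density h m z"
  by (simp add: pred_density_def prod_nonneg)

lemma normal_density_change_mean:
  "normal_density \<mu> \<sigma> y * exp (((y - \<mu>)\<^sup>2 - (y - \<nu>)\<^sup>2) / (2 * \<sigma>\<^sup>2)) = normal_density \<nu> \<sigma> y"
  by (simp add: normal_density_def mult.assoc exp_add[symmetric] diff_divide_distrib)

lemma density_mult_exp_llr: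
  "(\<Prod>i<m. normal_density (f (fst (z (Suc i)))) \<sigma> (snd (z (Suc i)))) * exp (llr h f m z) = pred_density h m z"
  by (simp add: llr_def pred_density_def exp_sum prod.distrib[symmetric] normal_density_change_mean)

text \<open>A change of measure: \<open>exp (llr h f m z)\<close> is the ratio of the predictive
  density to the density under \<open>f\<close>, so weighting the law under \<open>f\<close> by it
  gives the predictive law.\<close>

lemma nn_integral_exp_llr:
  assumes f [measurable]: "f \<in> borel_measurable P" and h: "\<And>i. i < m \<Longrightarrow> is_estimator P i (h i)"
    and [measurable]: "u \<in> borel_measurable (data_space P m)"
  shows "(\<integral>\<^sup>+ z. ennreal (exp (llr h f m z)) * u z \<partial>PiM {1..m} (\<lambda>_. obs f)) =
    (\<integral>\<^sup>+ z. ennreal (pred_density h m z) * u z \<partial>PiM {1..m} (\<lambda>_. P \<Otimes>\<^sub>M lborel))"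
proof -
  note [measurable] = measurable_llr[OF h f] measurable_observation
  show ?thesis
    unfolding PiM_obs_density[OF f]
    by (subst nn_integral_density, measurable)
      (auto simp: density_mult_exp_llr[symmetric, where f=f] ennreal_mult prod_nonneg mult.assoc intro!: nn_integral_cong)
qed

text \<open>Integrate out the last observation first: given the past and the design point, the
  response has a normal density with a fixed mean, which integrates to \<open>1\<close>, and
  \<open>P\<close> has total mass \<open>1\<close>.\<close>

lemma nn_integral_pred_density:
  assumes "\<And>i. i < m \<Longrightarrow> is_estimator P i (h i)"
  shows "(\<integral>\<^sup>+ z. ennreal (pred_density h m z) \<partial>PiM {1..m} (\<lambda>_. P \<Otimes>\<^sub>M lborel)) = 1"
  using assms
proof (induction m)
  case 0
  show ?case by (simp add: pred_density_def PiM_empty nn_integral_count_space_finite)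
next
  case (Suc m)
  interpret L: product_sigma_finite "\<lambda>_. P \<Otimes>\<^sub>M (lborel :: real measure)"
    by (rule product_sigma_finite_lborel)
  have eq: "{1..Suc m} = insert (Suc m) {1..m}" by auto
  have qm [measurable]: "pred_density h (Suc m) \<in> borel_measurable (PiM {1..Suc m} (\<lambda>_. P \<Otimes>\<^sub>M lborel))"
    using measurable_pred_density[OF Suc.prems] by simp
  have "(\<integral>\<^sup>+ z. ennreal (pred_density h (Suc m) z) \<partial>PiM {1..Suc m} (\<lambda>_. P \<Otimes>\<^sub>M lborel)) =
      (\<integral>\<^sup>+ d. \<integral>\<^sup>+ w. ennreal (pred_density h (Suc m) (d(Suc m := w))) \<partial>(P \<Otimes>\<^sub>M lborel)
        \<partial>PiM {1..m} (\<lambda>_. P \<Otimes>\<^sub>M lborel))"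
    using qm unfolding eq by (subst L.product_nn_integral_insert) auto
  also have "\<dots> = (\<integral>\<^sup>+ d. ennreal (pred_density h m d) \<partial>PiM {1..m} (\<lambda>_. P \<Otimes>\<^sub>M lborel))"
  proof (rule nn_integral_cong)
    fix d assume d: "d \<in> space (PiM {1..m} (\<lambda>_. P \<Otimes>\<^sub>M (lborel :: real measure)))"
    then have ext: "restrict d {1..m} = d" by (auto simp: space_PiM PiE_def extensional_restrict)
    \<comment> \<open>The coordinate \<open>Suc m\<close> is invisible to every \<open>h i\<close>
      with \<open>i \<le> m\<close>, so only the last factor depends on \<open>w\<close>.\<close>
    have res: "restrict (d(Suc m := w)) {1..i} = restrict d {1..i}" if "i \<le> m" for w i
      using that by (auto simp: fun_eq_iff)
    have q: "pred_density h (Suc m) (d(Suc m := w)) =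
        pred_density h m d * normal_density (h m d (fst w)) \<sigma> (snd w)" for w
      unfolding pred_density_def by (simp add: res res[simplified] ext ext[simplified])
    have "is_estimator P m (h m)" using Suc.prems by simp
    then have [measurable]: "(\<lambda>x. h m d x) \<in> borel_measurable P"
      unfolding is_estimator_def using d measurable_compose[OF measurable_Pair1'] by fastforce
    have "(\<integral>\<^sup>+ w. ennreal (normal_density (h m d (fst w)) \<sigma> (snd w)) \<partial>(P \<Otimes>\<^sub>M lborel)) =
        (\<integral>\<^sup>+ x. \<integral>\<^sup>+ y. ennreal (normal_density (h m d x) \<sigma> y) \<partial>lborel \<partial>P)"
      by (subst lborel.nn_integral_fst[symmetric]) auto
    also have "\<dots> = 1"
      using sigma_pos by (simp add: nn_integral_eq_integral emeasure_space_1)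
    finally have one: "(\<integral>\<^sup>+ w. ennreal (normal_density (h m d (fst w)) \<sigma> (snd w)) \<partial>(P \<Otimes>\<^sub>M lborel)) = 1" .
    show "(\<integral>\<^sup>+ w. ennreal (pred_density h (Suc m) (d(Suc m := w))) \<partial>(P \<Otimes>\<^sub>M lborel)) =
        ennreal (pred_density h m d)"
      by (simp add: q ennreal_mult pred_density_nonneg nn_integral_cmult one)
  qed
  also have "\<dots> = 1" using Suc by simp
  finally show ?case .
qed

section \<open>Relative entropy bounded by the cumulative risk\<close>

lemma noise_moments:
  "integrable N (\<lambda>z. z)" "(\<integral> z. z \<partial>N) = 0"
proof -
  have "(\<lambda>z::real. z) \<in> borel_measurable lborel" by simp
  then show "integrable N (\<lambda>z. z)" "(\<integral> z. z \<partial>N) = 0"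
    using integrable_normal_moment_nz_1[OF sigma_pos, of 0] integral_normal_moment_nz_1[OF sigma_pos, of 0]
    by (auto simp: integrable_density integral_density)
qed

text \<open>The chain rule for relative entropy. With response \<open>f x + z\<close> and estimation
  error \<open>\<Delta> = f x - h m d x\<close>, the new summand is \<open>- (2 * \<Delta> * z +
  \<Delta>\<^sup>2) / (2 * \<sigma>\<^sup>2)\<close>. The cross term has mean zero since
  \<open>z\<close> is centred and independent of the past and the design, so observation
  \<open>Suc m\<close> costs at most \<open>r m / (2 * \<sigma>\<^sup>2)\<close>. Integrability is
  carried through the same induction.\<close>

lemma integral_llr:
  assumes f [measurable]: "f \<in> borel_measurable P" and h: "\<And>i. i < m \<Longrightarrow> is_estimator P i (h i)"
    and r: "\<And>i. i < m \<Longrightarrow>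
      (\<integral>\<^sup>+ d. L2_norm_sq P (\<lambda>x. f x - h i d x) \<partial>PiM {1..i} (\<lambda>_. obs f)) \<le> ennreal (r i)"
    and r0: "\<And>i. i < m \<Longrightarrow> 0 \<le> r i"
  shows "integrable (PiM {1..m} (\<lambda>_. obs f)) (llr h f m) \<and>
    - (\<Sum>i<m. r i) / (2 * \<sigma>\<^sup>2) \<le> (\<integral> z. llr h f m z \<partial>PiM {1..m} (\<lambda>_. obs f))"
  using h r r0
proof (induction m)
  case 0
  interpret D: prob_space "PiM {1..0::nat} (\<lambda>_. obs f)"
    by (intro prob_space_PiM prob_space_obs f)
  have "llr h f 0 = (\<lambda>_. 0)" by (simp add: llr_def fun_eq_iff)
  then show ?case by simp
next
  case (Suc m)
  define D where "D = PiM {1..m} (\<lambda>_. obs f)"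
  define D' where "D' = PiM {1..Suc m} (\<lambda>_. obs f)"
  define K where "K = D \<Otimes>\<^sub>M P"
  have sD [measurable_cong]: "sets D = sets (data_space P m)" by (simp add: D_def)
  have spD: "space D = space (data_space P m)" by (simp add: D_def)
  interpret D: prob_space D unfolding D_def by (intro prob_space_PiM prob_space_obs f)
  interpret N: prob_space N by (rule prob_space_N)
  interpret DP: pair_prob_space D P by unfold_locales
  interpret K: prob_space K unfolding K_def by unfold_locales
  interpret KN: pair_prob_space K N by unfold_locales
  define \<Delta> where "\<Delta> = (\<lambda>(d, x). f x - h m d x)"
  have est [measurable]: "(\<lambda>(d, x). h m d x) \<in> borel_measurable (data_space P m \<Otimes>\<^sub>M P)"
    using Suc.prems(1)[of m] by (simp add: is_estimator_def)
  have \<Delta> [measurable]: "\<Delta> \<in> borel_measurable K"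
  proof -
    have [measurable]: "(\<lambda>(d, x). h m d x) \<in> borel_measurable (D \<Otimes>\<^sub>M P)"
      using est by (subst measurable_cong_sets[OF sets_pair_measure_cong[OF sD refl] refl])
    have "(\<lambda>p. f (snd p) - (\<lambda>(d, x). h m d x) p) \<in> borel_measurable (D \<Otimes>\<^sub>M P)" by measurable
    then show ?thesis by (simp add: \<Delta>_def K_def split_beta')
  qed
  have IH: "integrable D (llr h f m)" "- (\<Sum>i<m. r i) / (2 * \<sigma>\<^sup>2) \<le> (\<integral> z. llr h f m z \<partial>D)"
    using Suc unfolding D_def by auto
  have \<Delta>2: "(\<integral>\<^sup>+ k. ennreal ((\<Delta> k)\<^sup>2) \<partial>K) \<le> ennreal (r m)"
  proof -
    have "(\<integral>\<^sup>+ k. ennreal ((\<Delta> k)\<^sup>2) \<partial>K) = (\<integral>\<^sup>+ d. \<integral>\<^sup>+ x. ennreal ((\<Delta> (d, x))\<^sup>2) \<partial>P \<partial>D)"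
      using \<Delta> unfolding K_def by (subst nn_integral_fst) auto
    also have "\<dots> = (\<integral>\<^sup>+ d. L2_norm_sq P (\<lambda>x. f x - h m d x) \<partial>D)"
      by (simp add: L2_norm_sq_def \<Delta>_def)
    finally show ?thesis using Suc.prems(2)[of m] by (simp add: D_def)
  qed
  have i2: "integrable K (\<lambda>k. (\<Delta> k)\<^sup>2)"
    using \<Delta>2 by (intro integrableI_bounded) (auto simp: le_less_trans[OF _ ennreal_less_top])
  have I2: "(\<integral> k. (\<Delta> k)\<^sup>2 \<partial>K) \<le> r m"
    using \<Delta>2 Suc.prems(3)[of m] i2 by (subst (asm) nn_integral_eq_integral) auto
  \<comment> \<open>A first moment is needed for the cross term; it follows from the second moment
    because constants are integrable on a probability space.\<close>
  have i1: "integrable K \<Delta>"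
  proof (rule Bochner_Integration.integrable_bound)
    show "integrable K (\<lambda>k. 1 + (\<Delta> k)\<^sup>2)" using i2 by simp
    have "\<bar>t\<bar> \<le> 1 + t\<^sup>2" for t :: real
      using zero_le_power2[of "\<bar>t\<bar> - 1"] by (simp add: power2_diff)
    then show "AE k in K. norm (\<Delta> k) \<le> norm (1 + (\<Delta> k)\<^sup>2)" by (auto simp: abs_of_nonneg)
  qed simp
  let ?KN = "K \<Otimes>\<^sub>M N"
  have dK: "distr ?KN K fst = K" by (rule N.distr_pair_fst)
  have dD: "distr K D fst = D" unfolding K_def by (rule distr_pair_fst)
  have [measurable]: "fst \<in> K \<rightarrow>\<^sub>M D" unfolding K_def by measurable
  have lm [measurable]: "llr h f m \<in> borel_measurable D"
    using measurable_llr[OF _ f, of m h] Suc.prems(1) sD by (simp cong: measurable_cong_sets)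
  have il: "integrable K (\<lambda>k. llr h f m (fst k))" "(\<integral> k. llr h f m (fst k) \<partial>K) = (\<integral> d. llr h f m d \<partial>D)"
    using IH(1) integrable_distr_eq[of fst K D "llr h f m"] integral_distr[of fst K D "llr h f m"]
    by (simp_all add: dD)
  have lift: "integrable ?KN (\<lambda>p. g (fst p))" "(\<integral> p. g (fst p) \<partial>?KN) = (\<integral> k. g k \<partial>K)"
    if "integrable K g" for g :: "_ \<Rightarrow> real"
    using that integrable_distr_eq[of fst ?KN K g] integral_distr[of fst ?KN K g]
    by (simp_all add: dK)
  have cross: "integrable ?KN (\<lambda>(k, z). \<Delta> k * z)"
  proof (rule KN.Fubini_integrable)
    show "integrable K (\<lambda>k. \<integral> z. norm (case (k, z) of (k, z) \<Rightarrow> \<Delta> k * z) \<partial>N)"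
      using i1 by (simp add: abs_mult)
    show "AE k in K. integrable N (\<lambda>z. case (k, z) of (k, z) \<Rightarrow> \<Delta> k * z)"
      using noise_moments by simp
  qed measurable
  have Cross: "(\<integral> p. (case p of (k, z) \<Rightarrow> \<Delta> k * z) \<partial>?KN) = 0"
    using KN.integral_fst'[OF cross] noise_moments(2) by simp
  \<comment> \<open>\<open>g\<close> is the log-likelihood ratio of \<open>Suc m\<close>
    observations in the coordinates past, design point and noise; this is checked in
    \<open>lH\<close> below.\<close>
  define g where "g = (\<lambda>p. llr h f m (fst (fst p)) - (2 * (case p of (k, z) \<Rightarrow> \<Delta> k * z) + (\<Delta> (fst p))\<^sup>2) / (2 * \<sigma>\<^sup>2))"
  have ig: "integrable ?KN g"
    unfolding g_def using lift(1)[OF il(1)] lift(1)[OF i2] cross by auto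
  have "(\<integral> p. g p \<partial>?KN) = (\<integral> d. llr h f m d \<partial>D) - (\<integral> k. (\<Delta> k)\<^sup>2 \<partial>K) / (2 * \<sigma>\<^sup>2)"
    unfolding g_def using lift[OF il(1)] lift[OF i2] cross Cross il(2) by simp
  moreover have "(\<integral> k. (\<Delta> k)\<^sup>2 \<partial>K) / (2 * \<sigma>\<^sup>2) \<le> r m / (2 * \<sigma>\<^sup>2)"
    using I2 by (intro divide_right_mono) auto
  ultimately have Ig: "- (\<Sum>i<Suc m. r i) / (2 * \<sigma>\<^sup>2) \<le> (\<integral> p. g p \<partial>?KN)"
    using IH(2) by (simp add: add_divide_distrib diff_divide_distrib)
  let ?H = "\<lambda>((d, x), z). d(Suc m := (x, f x + z))"
  have D': "D' = distr ?KN (data_space P (Suc m)) ?H"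
    unfolding D'_def K_def D_def by (rule PiM_obs_Suc[OF f])
  have eq: "{1..Suc m} = insert (Suc m) {1..m}" by auto
  have H [measurable]: "?H \<in> ?KN \<rightarrow>\<^sub>M data_space P (Suc m)"
    unfolding split_beta' eq K_def D_def by (rule measurable_fun_upd[where J="{1..m}"]) auto
  have lH: "llr h f (Suc m) (?H p) = g p" if p: "p \<in> space ?KN" for p
  proof -
    obtain d x z where pe: "p = ((d, x), z)" by (metis prod.exhaust)
    with p have "d \<in> space (data_space P m)" by (auto simp: space_pair_measure K_def spD)
    then have ext: "restrict d {1..m} = d" by (auto simp: space_PiM PiE_def extensional_restrict)
    have res: "restrict (d(Suc m := w)) {1..i} = restrict d {1..i}" if "i \<le> m" for w i
      using that by (auto simp: fun_eq_iff)
    have "z\<^sup>2 - (f x + z - h m d x)\<^sup>2 = - (2 * (\<Delta> (d, x) * z) + (\<Delta> (d, x))\<^sup>2)"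
      by (simp add: \<Delta>_def power2_eq_square algebra_simps)
    then show ?thesis
      unfolding llr_def g_def pe by (simp add: res res[simplified] ext ext[simplified] minus_divide_left)
  qed
  have lS: "llr h f (Suc m) \<in> borel_measurable (data_space P (Suc m))"
    using measurable_llr[OF _ f, of "Suc m" h] Suc.prems(1) by simp
  have "integrable D' (llr h f (Suc m))"
    unfolding D' using ig lH by (subst integrable_distr_eq[OF H lS]) (simp cong: Bochner_Integration.integrable_cong)
  moreover have "(\<integral> z. llr h f (Suc m) z \<partial>D') = (\<integral> p. g p \<partial>?KN)"
    unfolding D' using lH by (subst integral_distr[OF H lS]) (simp cong: Bochner_Integration.integral_cong)
  ultimately show ?case using Ig unfolding D'_def by simp
qed

end

section \<open>Separation of packing points in squared norm\<close>

lemma measurable_L2_norm_sq_estimate: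
  assumes "prob_space P" and [measurable]: "f \<in> borel_measurable P" and "is_estimator P m h"
  shows "(\<lambda>d. L2_norm_sq P (\<lambda>x. f x - h d x)) \<in> borel_measurable (data_space P m)"
proof -
  interpret prob_space P by fact
  have [measurable]: "(\<lambda>(d, x). h d x) \<in> borel_measurable (data_space P m \<Otimes>\<^sub>M P)"
    using assms(3) by (simp add: is_estimator_def)
  have "(\<lambda>p. ennreal ((f (snd p) - (\<lambda>(d, x). h d x) p)\<^sup>2)) \<in> borel_measurable (data_space P m \<Otimes>\<^sub>M P)"
    by measurable
  from borel_measurable_nn_integral_fst[OF this] show ?thesis
    by (simp add: L2_norm_sq_def)
qed

text \<open>Pointwise this is \<open>(u + v)\<^sup>2 \<ge> 0\<close> with
  \<open>u = f x - h x\<close> and \<open>v = g x - h x\<close>. Working in \<open>ennreal\<close>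
  allows infinite norms.\<close>

lemma L2_norm_sq_parallelogram:
  assumes [measurable]: "f \<in> borel_measurable P" "g \<in> borel_measurable P" "h \<in> borel_measurable P"
  shows "L2_norm_sq P (\<lambda>x. f x - g x) \<le> 2 * L2_norm_sq P (\<lambda>x. f x - h x) + 2 * L2_norm_sq P (\<lambda>x. g x - h x)"
proof -
  have "L2_norm_sq P (\<lambda>x. f x - g x) \<le> (\<integral>\<^sup>+ x. 2 * ennreal ((f x - h x)\<^sup>2) + 2 * ennreal ((g x - h x)\<^sup>2) \<partial>P)"
    unfolding L2_norm_sq_def
  proof (rule nn_integral_mono)
    fix x
    have "(f x - g x)\<^sup>2 \<le> 2 * (f x - h x)\<^sup>2 + 2 * (g x - h x)\<^sup>2"
      using zero_le_power2[of "(f x - h x) + (g x - h x)"] by (simp add: power2_eq_square algebra_simps)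
    then have "ennreal ((f x - g x)\<^sup>2) \<le> ennreal (2 * (f x - h x)\<^sup>2 + 2 * (g x - h x)\<^sup>2)"
      by (rule ennreal_leI)
    then show "ennreal ((f x - g x)\<^sup>2) \<le> 2 * ennreal ((f x - h x)\<^sup>2) + 2 * ennreal ((g x - h x)\<^sup>2)"
      by (simp add: ennreal_mult)
  qed
  also have "\<dots> = 2 * L2_norm_sq P (\<lambda>x. f x - h x) + 2 * L2_norm_sq P (\<lambda>x. g x - h x)"
    unfolding L2_norm_sq_def by (simp add: nn_integral_add nn_integral_cmult)
  finally show ?thesis .
qed

text \<open>The threshold \<open>\<epsilon>\<^sup>2 / 4\<close> is chosen so that two close centres
  would have squared distance at most
  \<open>4 * (\<epsilon>\<^sup>2 / 4) = \<epsilon>\<^sup>2\<close>, against the strict separation in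
  a packing. It makes the events \<open>A f\<close> below disjoint.\<close>

lemma packing_unique_center:
  assumes pack: "is_packing P \<epsilon> \<F> S" and "\<epsilon> > 0" and fg: "f \<in> S" "g \<in> S"
    and meas: "f \<in> borel_measurable P" "g \<in> borel_measurable P" "h \<in> borel_measurable P"
    and close: "L2_norm_sq P (\<lambda>x. f x - h x) \<le> ennreal (\<epsilon>\<^sup>2 / 4)"
      "L2_norm_sq P (\<lambda>x. g x - h x) \<le> ennreal (\<epsilon>\<^sup>2 / 4)"
  shows "f = g"
proof (rule ccontr)
  assume "f \<noteq> g"
  then have far: "\<epsilon> < L2_dist P f g" using pack fg by (auto simp: is_packing_def)
  have "L2_norm_sq P (\<lambda>x. f x - g x) \<le> 2 * ennreal (\<epsilon>\<^sup>2 / 4) + 2 * ennreal (\<epsilon>\<^sup>2 / 4)"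
    using L2_norm_sq_parallelogram[OF meas] close by (meson add_mono mult_left_mono order_trans zero_le)
  also have "\<dots> = ennreal (2 * (\<epsilon>\<^sup>2 / 4) + 2 * (\<epsilon>\<^sup>2 / 4))"
    by (simp only: ennreal_plus ennreal_mult zero_le_power2 divide_nonneg_nonneg mult_nonneg_nonneg
      zero_le_numeral ennreal_numeral)
  also have "\<dots> = ennreal (\<epsilon>\<^sup>2)" by simp
  finally have "enn2real (L2_norm_sq P (\<lambda>x. f x - g x)) \<le> \<epsilon>\<^sup>2"
    by (simp add: enn2real_leI)
  then have "L2_dist P f g \<le> \<epsilon>"
    unfolding L2_dist_def using \<open>\<epsilon> > 0\<close> by (simp add: real_le_lsqrt)
  with far show False by simp
qed

section \<open>Fano's inequality on a finite packing\<close>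

context gaussian_regression
begin

text \<open>The bound is kept multiplied out, not divided by \<open>ln (real (card S))\<close>, so
  that it also serves for packings of unbounded size, where only the left side grows.\<close>

lemma fano_packing_bound:
  assumes fin: "finite S" and card: "card S \<ge> 2" and pack: "is_packing P \<epsilon> \<F> S" and \<epsilon>: "\<epsilon> > 0"
    and S: "\<And>f. f \<in> S \<Longrightarrow> f \<in> borel_measurable P"
    and h: "\<And>i. i \<le> n \<Longrightarrow> is_estimator P i (h i)"
    and r: "\<And>f i. f \<in> S \<Longrightarrow> i \<le> n \<Longrightarrow>
      (\<integral>\<^sup>+ d. L2_norm_sq P (\<lambda>x. f x - h i d x) \<partial>PiM {1..i} (\<lambda>_. obs f)) \<le> ennreal (r i)"
    and r0: "\<And>i. i \<le> n \<Longrightarrow> 0 \<le> r i"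
  shows "(1 - 4 * r n / \<epsilon>\<^sup>2) * ln (real (card S)) \<le> (\<Sum>i<n. r i) / (2 * \<sigma>\<^sup>2) + ln 2"
proof -
  define a where "a = real (card S)"
  define R where "R = (\<Sum>i<n. r i) / (2 * \<sigma>\<^sup>2)"
  define Q where "Q = density (PiM {1..n} (\<lambda>_. P \<Otimes>\<^sub>M lborel)) (\<lambda>z. ennreal (pred_density h n z))"
  define A where "A f = {z \<in> space (data_space P n). L2_norm_sq P (\<lambda>x. f x - h n z x) \<le> ennreal (\<epsilon>\<^sup>2 / 4)}" for f
  define D where "D f = PiM {1..n} (\<lambda>_. obs f)" for f
  have a: "a \<ge> 2" using card by (simp add: a_def)
  have h': "i < n \<Longrightarrow> is_estimator P i (h i)" for i using h by simp
  have sQ [measurable_cong]: "sets Q = sets (data_space P n)" by (simp add: Q_def)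
  have sD [measurable_cong]: "sets (D f) = sets (data_space P n)" for f by (simp add: D_def)
  have spD: "space (D f) = space (data_space P n)" for f by (simp add: D_def)
  have mq: "pred_density h n \<in> borel_measurable (PiM {1..n} (\<lambda>_. P \<Otimes>\<^sub>M lborel))"
    using measurable_pred_density[OF h'] by (subst measurable_cong_sets[OF sets_PiM_lborel refl])
  interpret Q: prob_space Q
  proof
    have "emeasure Q (space Q) = (\<integral>\<^sup>+ z. 1 \<partial>Q)" by simp
    also have "\<dots> = 1"
      unfolding Q_def using mq nn_integral_pred_density[OF h'] by (subst nn_integral_density) auto
    finally show "emeasure Q (space Q) = 1" .
  qed
  have A [measurable]: "A f \<in> sets (data_space P n)" if "f \<in> S" for f
    unfolding A_def using measurable_L2_norm_sq_estimate[OF prob_space_axioms S[OF that] h[of n]]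
    by measurable
  have AQ: "A f \<in> sets Q" if "f \<in> S" for f using A[OF that] by (simp add: sQ)
  have "disjoint_family_on A S"
    unfolding disjoint_family_on_def
  proof (intro ballI impI)
    fix f g assume fg: "f \<in> S" "g \<in> S" "f \<noteq> g"
    have "False" if "z \<in> A f" "z \<in> A g" for z
    proof -
      have z: "z \<in> space (data_space P n)" using that by (simp add: A_def)
      have "h n z \<in> borel_measurable P"
        using h[of n] z measurable_compose[OF measurable_Pair1'] unfolding is_estimator_def by fastforce
      then show False
        using packing_unique_center[OF pack \<epsilon> fg(1,2), of "h n z"] S fg that by (auto simp: A_def)
    qed
    then show "A f \<inter> A g = {}" by auto
  qed
  then have c: "(\<Sum>f\<in>S. Q.prob (A f)) \<le> 1"
    using AQ by (subst Q.finite_measure_finite_Union[symmetric, OF fin]) auto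
  have main: "ln a * (1 - 4 * r n / \<epsilon>\<^sup>2) - R - ln 2 \<le> (1 + a * Q.prob (A f)) / 2 - 1" if f: "f \<in> S" for f
  proof -
    note [measurable] = S[OF f] A[OF f]
    interpret D: prob_space "D f" unfolding D_def by (intro prob_space_PiM prob_space_obs S f)
    let ?l = "llr h f n" and ?I = "indicator (A f) :: _ \<Rightarrow> real"
    have llr: "integrable (D f) ?l" "- R \<le> (\<integral> z. ?l z \<partial>D f)"
      using integral_llr[OF S[OF f] h', of n r] r[OF f] r0 unfolding D_def R_def by auto
    have ml [measurable]: "?l \<in> borel_measurable (data_space P n)"
      by (rule measurable_llr[OF h' S[OF f]])
    have iI: "integrable (D f) ?I" "(\<integral> z. ?I z \<partial>D f) = D.prob (A f)"
      using A[OF f] sD[of f] by (auto intro!: D.integrable_const_bound[where B=1])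
    have prob: "1 - 4 * r n / \<epsilon>\<^sup>2 \<le> D.prob (A f)"
    proof -
      \<comment> \<open>Markov's inequality: off \<open>A f\<close> the loss exceeds
        \<open>\<epsilon>\<^sup>2 / 4\<close>.\<close>
      have "ennreal (\<epsilon>\<^sup>2 / 4) * emeasure (D f) (space (D f) - A f) =
          (\<integral>\<^sup>+ z. ennreal (\<epsilon>\<^sup>2 / 4) * indicator (space (D f) - A f) z \<partial>D f)"
        using A[OF f] sD[of f] by (intro nn_integral_cmult_indicator[symmetric]) auto
      also have "\<dots> \<le> (\<integral>\<^sup>+ z. L2_norm_sq P (\<lambda>x. f x - h n z x) \<partial>D f)"
        by (intro nn_integral_mono) (auto simp: A_def spD indicator_def)
      also have "\<dots> \<le> ennreal (r n)" using r[OF f, of n] by (simp add: D_def)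
      finally have "\<epsilon>\<^sup>2 / 4 * D.prob (space (D f) - A f) \<le> r n"
        using r0[of n] by (simp add: D.emeasure_eq_measure ennreal_mult[symmetric] del: ennreal_mult)
      moreover have "D.prob (space (D f) - A f) = 1 - D.prob (A f)"
        using A[OF f] sD[of f] by (intro D.prob_compl) auto
      ultimately show ?thesis using \<epsilon> by (simp add: field_simps)
    qed
    \<comment> \<open>The factor \<open>1 + a * ?I z\<close> dominates
      \<open>exp (ln a * ?I z)\<close>, which is \<open>a\<close> on \<open>A f\<close> and
      \<open>1\<close> off it. Weighted by the likelihood ratio, it has mean
      \<open>1 + a * Q.prob (A f)\<close> under \<open>D f\<close>.\<close>
    let ?u = "\<lambda>z. exp (?l z) * (1 + a * ?I z)"
    have "(\<integral>\<^sup>+ z. ennreal (?u z) \<partial>D f) = (\<integral>\<^sup>+ z. ennreal (exp (?l z)) * ennreal (1 + a * ?I z) \<partial>D f)"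
      using a by (intro nn_integral_cong) (simp add: ennreal_mult)
    also have "\<dots> = (\<integral>\<^sup>+ z. ennreal (pred_density h n z) * ennreal (1 + a * ?I z) \<partial>PiM {1..n} (\<lambda>_. P \<Otimes>\<^sub>M lborel))"
      unfolding D_def by (rule nn_integral_exp_llr[OF S[OF f] h']) measurable
    also have "\<dots> = (\<integral>\<^sup>+ z. ennreal (1 + a * ?I z) \<partial>Q)"
      unfolding Q_def by (rule nn_integral_density[symmetric]) (use mq in measurable)
    also have "\<dots> = ennreal (\<integral> z. 1 + a * ?I z \<partial>Q)"
      using a AQ[OF f] by (intro nn_integral_eq_integral) (auto simp: Q.emeasure_eq_measure)
    also have "(\<integral> z. 1 + a * ?I z \<partial>Q) = 1 + a * Q.prob (A f)"
      using AQ[OF f] by (simp add: Q.emeasure_eq_measure Q.prob_space)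
    finally have nn: "(\<integral>\<^sup>+ z. ennreal (?u z) \<partial>D f) = ennreal (1 + a * Q.prob (A f))" .
    have mu: "?u \<in> borel_measurable (D f)" by measurable
    have iu: "integrable (D f) ?u"
      using a mu nn by (intro integrableI_nonneg) (auto intro!: AE_I2 mult_nonneg_nonneg)
    have Iu: "(\<integral> z. ?u z \<partial>D f) = 1 + a * Q.prob (A f)"
    proof (subst integral_eq_nn_integral[OF mu])
      show "enn2real (\<integral>\<^sup>+ z. ennreal (?u z) \<partial>D f) = 1 + a * Q.prob (A f)"
        unfolding nn using a by (intro enn2real_ennreal) simp
    qed (use a in simp_all)
    have "ln a * D.prob (A f) + (\<integral> z. ?l z \<partial>D f) - ln 2 = (\<integral> z. ln a * ?I z + ?l z - ln 2 \<partial>D f)"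
      using iI llr by (simp add: D.prob_space)
    also have "\<dots> \<le> (\<integral> z. ?u z / 2 - 1 \<partial>D f)"
    proof (rule integral_mono)
      fix z
      have "ln a * ?I z + ?l z - ln 2 \<le> exp (ln a * ?I z + ?l z - ln 2) - 1"
        using exp_ge_add_one_self[of "ln a * ?I z + ?l z - ln 2"] by linarith
      also have "\<dots> = exp (ln a * ?I z) * exp (?l z) / 2 - 1"
        by (simp add: exp_diff exp_add)
      also have "\<dots> \<le> ?u z / 2 - 1"
        using a by (auto simp: indicator_def)
      finally show "ln a * ?I z + ?l z - ln 2 \<le> ?u z / 2 - 1" .
    qed (use iI llr iu in auto)
    also have "\<dots> = (1 + a * Q.prob (A f)) / 2 - 1"
      using iu Iu by (simp add: D.prob_space)
    finally have "ln a * D.prob (A f) + (\<integral> z. ?l z \<partial>D f) - ln 2 \<le> (1 + a * Q.prob (A f)) / 2 - 1" .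
    moreover have "ln a * (1 - 4 * r n / \<epsilon>\<^sup>2) \<le> ln a * D.prob (A f)"
      using a prob by (intro mult_left_mono) auto
    ultimately show ?thesis using llr(2) by linarith
  qed
  have "a * (ln a * (1 - 4 * r n / \<epsilon>\<^sup>2) - R - ln 2) \<le> (\<Sum>f\<in>S. (1 + a * Q.prob (A f)) / 2 - 1)"
    using sum_mono[OF main] by (simp add: a_def)
  also have "\<dots> = a / 2 + a / 2 * (\<Sum>f\<in>S. Q.prob (A f)) - a"
    by (simp add: sum_subtractf sum.distrib add_divide_distrib sum_divide_distrib[symmetric]
      sum_distrib_left[symmetric] a_def)
  \<comment> \<open>The right side is \<open>0\<close>. The shift by \<open>ln 2\<close> halves the
    exponential, whose two contributions, \<open>a\<close> from the constant part and at most
    \<open>a\<close> from the events, then cancel against \<open>- a\<close>.\<close>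
  also have "\<dots> \<le> a / 2 + a / 2 * 1 - a"
    using a c by (intro diff_right_mono add_left_mono mult_left_mono) auto
  finally have "ln a * (1 - 4 * r n / \<epsilon>\<^sup>2) - R - ln 2 \<le> 0"
    using a by (simp add: mult_le_0_iff)
  then show ?thesis by (simp add: a_def R_def mult.commute)
qed

lemma risk_eq_nn_integral_obs:
  assumes "regression_model \<Omega> P \<sigma> X e" and "f \<in> borel_measurable P" and "is_estimator P m h"
  shows "risk \<Omega> P X e m h f = (\<integral>\<^sup>+ d. L2_norm_sq P (\<lambda>x. f x - h d x) \<partial>PiM {1..m} (\<lambda>_. obs f))"
proof -
  have "risk \<Omega> P X e m h f =
      (\<integral>\<^sup>+ d. L2_norm_sq P (\<lambda>x. f x - h d x) \<partial>distr \<Omega> (data_space P m) (regression_data X e f m))"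
    unfolding risk_def
    using distr_regression_data(2)[OF assms(1,2)]
      measurable_L2_norm_sq_estimate[OF prob_space_axioms assms(2,3)]
    by (subst nn_integral_distr) auto
  then show ?thesis by (simp only: distr_regression_data(1)[OF assms(1,2)])
qed

end

section \<open>From finite packings to the packing number\<close>

text \<open>Subsets of packings are packings, so any packing with at least \<open>j\<close> members
  can be cut down to exactly \<open>j\<close>.\<close>

lemma packing_of_card:
  assumes "enat j \<le> packing_number P \<epsilon> \<F>"
  obtains S where "is_packing P \<epsilon> \<F> S" "finite S" "card S = j"
proof (cases j)
  case 0
  then show ?thesis using that[of "{}"] by (simp add: is_packing_def)
next
  case (Suc i)
  \<comment> \<open>Stepping down from \<open>j\<close> to \<open>i\<close> makes the inequality
    strict, so that the supremum yields an actual packing.\<close>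
  then have "enat i < packing_number P \<epsilon> \<F>" using assms by (simp add: Suc_ile_eq)
  then obtain S where S: "is_packing P \<epsilon> \<F> S" "enat i < (if finite S then enat (card S) else \<infinity>)"
    unfolding packing_number_def less_SUP_iff by blast
  obtain T where T: "T \<subseteq> S" "finite T" "card T = j"
  proof (cases "finite S")
    case True
    then have "j \<le> card S" using S(2) Suc by simp
    then show ?thesis using that by (meson obtain_subset_with_card_n)
  next
    case False
    then show ?thesis using that by (meson infinite_arbitrarily_large)
  qed
  then show ?thesis using that[of T] S(1) by (auto simp: is_packing_def)
qed

text \<open>\<open>ln\<close> is unbounded, so a positive \<open>c\<close> would break any bound.
  This settles the case of an infinite packing number.\<close>

lemma nonpos_if_mult_ln_bounded:
  assumes "\<And>j::nat. j \<ge> 2 \<Longrightarrow> c * ln (real j) \<le> K"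
  shows "c \<le> 0"
proof (rule ccontr)
  assume "\<not> c \<le> 0"
  \<comment> \<open>This \<open>j\<close> has \<open>c * ln (real j) > \<bar>K\<bar> + c\<close>;
    the absolute value keeps the exponent nonnegative, which gives \<open>j \<ge> 2\<close>.\<close>
  obtain j :: nat where j: "exp (\<bar>K\<bar> / c + 1) < real j" using reals_Archimedean2 by blast
  have "1 \<le> exp (\<bar>K\<bar> / c + 1)" using \<open>\<not> c \<le> 0\<close> by simp
  with j have "1 < real j" by linarith
  then have "j \<ge> 2" by simp
  have "\<bar>K\<bar> / c + 1 < ln (real j)" using j by (metis exp_gt_zero exp_less_cancel_iff exp_ln order_less_trans)
  then have "K < c * ln (real j)" using \<open>\<not> c \<le> 0\<close> by (simp add: field_simps)
  with assms[OF \<open>j \<ge> 2\<close>] show False by simp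
qed

theorem lemma3:
  fixes P :: "'a measure" and \<Omega> :: "'w measure"
    and B \<sigma> rstar :: real and n :: nat
    and \<F> :: "('a \<Rightarrow> real) set"
    and X :: "nat \<Rightarrow> 'w \<Rightarrow> 'a" and e :: "nat \<Rightarrow> 'w \<Rightarrow> real"
    and fhat :: "nat \<Rightarrow> (nat \<Rightarrow> 'a \<times> real) \<Rightarrow> 'a \<Rightarrow> real"
    and r :: "nat \<Rightarrow> real"
  assumes "prob_space P"
    and "B > 0" and "\<sigma> > 0" and "n \<ge> 1"
    and "\<F> \<noteq> {}"
    and "\<And>f. f \<in> \<F> \<Longrightarrow> f \<in> borel_measurable P"
    and "\<And>f x. f \<in> \<F> \<Longrightarrow> x \<in> space P \<Longrightarrow> f x \<in> {-B..B}"
    and "regression_model \<Omega> P \<sigma> X e"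
    and "\<And>m. m \<le> n \<Longrightarrow> is_estimator P m (fhat m)"
    and "\<And>m. m \<le> n \<Longrightarrow> enn2ereal (SUP f\<in>\<F>. risk \<Omega> P X e m (fhat m) f) \<le> ereal (r m)"
    and "real n * rstar = (\<Sum>m<n. r m)"
  shows "(\<forall>\<epsilon>>0. packing_number P \<epsilon> \<F> \<ge> 2 \<longrightarrow>
            ereal (r n) \<ge> ereal (\<epsilon>\<^sup>2 / 4) *
              (1 - ereal (real n * rstar / (2 * \<sigma>\<^sup>2) + ln 2) / ln_enat (packing_number P \<epsilon> \<F>)))
       \<and> (\<forall>\<epsilon>>0. \<epsilon>\<^sup>2 \<ge> 8 * r n \<longrightarrow>
            ln_enat (packing_number P \<epsilon> \<F>) \<le> ereal (real n * rstar / \<sigma>\<^sup>2 + 2 * ln 2))"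
proof -
  interpret prob_space P by fact
  interpret gaussian_regression P \<sigma> using \<open>\<sigma> > 0\<close> by unfold_locales
  define K where "K = real n * rstar / (2 * \<sigma>\<^sup>2) + ln 2"
  \<comment> \<open>Risks are nonnegative, hence so are their bounds. This matters because
    \<open>ennreal\<close> truncates negative reals to \<open>0\<close>, and it lets the
    \<open>ereal\<close> hypothesis pass to \<open>ennreal\<close>.\<close>
  have r0: "0 \<le> r m" if "m \<le> n" for m
    using order_trans[OF enn2ereal_nonneg assms(10)[OF that]] by simp
  have r: "(\<integral>\<^sup>+ d. L2_norm_sq P (\<lambda>x. f x - fhat m d x) \<partial>PiM {1..m} (\<lambda>_. obs f)) \<le> ennreal (r m)"
    if "f \<in> \<F>" "m \<le> n" for f m
  proof -
    have "(SUP f\<in>\<F>. risk \<Omega> P X e m (fhat m) f) \<le> ennreal (r m)"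
      using assms(10)[OF that(2)] r0[OF that(2)] by (simp add: less_eq_ennreal.rep_eq enn2ereal_ennreal)
    then have "risk \<Omega> P X e m (fhat m) f \<le> ennreal (r m)" using that(1) by (simp add: SUP_le_iff)
    then show ?thesis
      using risk_eq_nn_integral_obs[OF assms(8) assms(6)[OF that(1)] assms(9)[OF that(2)]] by simp
  qed
  have bound: "(1 - 4 * r n / \<epsilon>\<^sup>2) * ln (real j) \<le> K"
    if \<epsilon>: "\<epsilon> > 0" and j: "j \<ge> 2" "enat j \<le> packing_number P \<epsilon> \<F>" for \<epsilon> j
  proof -
    obtain S where S: "is_packing P \<epsilon> \<F> S" "finite S" "card S = j" using j(2) by (rule packing_of_card)
    then have "S \<subseteq> \<F>" by (simp add: is_packing_def)
    then show ?thesis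
      using fano_packing_bound[OF S(2) _ S(1) \<epsilon>, of n fhat r] S(3) j(1) assms(6,9) r r0
      by (auto simp: K_def assms(11) subset_iff)
  qed
  have bound_infinite: "1 - 4 * r n / \<epsilon>\<^sup>2 \<le> 0" if "\<epsilon> > 0" "packing_number P \<epsilon> \<F> = \<infinity>" for \<epsilon>
    using bound[OF that(1)] that(2) by (intro nonpos_if_mult_ln_bounded) auto
  have K: "K \<ge> 0"
    using r0 by (auto simp: K_def assms(11) intro!: add_nonneg_nonneg divide_nonneg_nonneg sum_nonneg)
  have "ereal (\<epsilon>\<^sup>2 / 4) * (1 - ereal K / ln_enat (packing_number P \<epsilon> \<F>)) \<le> ereal (r n)"
    if \<epsilon>: "\<epsilon> > 0" and two: "packing_number P \<epsilon> \<F> \<ge> 2" for \<epsilon>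
  proof (cases "packing_number P \<epsilon> \<F>")
    case (enat k)
    then have k: "k \<ge> 2" using two by (metis enat_ord_simps(1) numeral_eq_enat)
    then have l: "ln (real k) > 0" by simp
    have "1 - 4 * r n / \<epsilon>\<^sup>2 \<le> K / ln (real k)"
      using bound[OF \<epsilon> k] enat l by (simp add: pos_le_divide_eq)
    then have "\<epsilon>\<^sup>2 / 4 * (1 - K / ln (real k)) \<le> \<epsilon>\<^sup>2 / 4 * (4 * r n / \<epsilon>\<^sup>2)"
      by (intro mult_left_mono) auto
    then show ?thesis using \<epsilon> l by (simp add: enat ln_enat_def one_ereal_def)
  next
    case infinity
    \<comment> \<open>Here the quotient by \<open>\<infinity>\<close> is \<open>0\<close> and the
      claim reads \<open>\<epsilon>\<^sup>2 / 4 \<le> r n\<close>.\<close>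
    then show ?thesis using bound_infinite[OF \<epsilon>] \<epsilon> by (simp add: ln_enat_def field_simps)
  qed
  moreover have "ln_enat (packing_number P \<epsilon> \<F>) \<le> ereal (real n * rstar / \<sigma>\<^sup>2 + 2 * ln 2)"
    if \<epsilon>: "\<epsilon> > 0" and large: "\<epsilon>\<^sup>2 \<ge> 8 * r n" for \<epsilon>
  proof -
    \<comment> \<open>The factor \<open>8\<close> leaves at least half of the logarithm, so the
      bound is \<open>2 * K\<close>.\<close>
    have half: "1 / 2 \<le> 1 - 4 * r n / \<epsilon>\<^sup>2" using \<epsilon> large by (simp add: field_simps)
    have eq: "real n * rstar / \<sigma>\<^sup>2 + 2 * ln 2 = 2 * K" by (simp add: K_def field_simps)
    show ?thesis
    proof (cases "packing_number P \<epsilon> \<F>")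
      case (enat k)
      have "ln (real k) \<le> 2 * K"
      proof (cases "k \<ge> 2")
        case True
        have "1 / 2 * ln (real k) \<le> (1 - 4 * r n / \<epsilon>\<^sup>2) * ln (real k)"
          using True by (intro mult_right_mono half) auto
        then show ?thesis using bound[OF \<epsilon> True] enat by simp
      next
        case False
        \<comment> \<open>Both logarithms are \<open>0\<close>, with \<open>ln 0 = 0\<close> by
          convention, and \<open>2 * K\<close> is nonnegative.\<close>
        then have "k = 0 \<or> k = 1" by auto
        then show ?thesis using K by auto
      qed
      then show ?thesis unfolding eq by (simp add: enat ln_enat_def)
    next
      case infinity
      \<comment> \<open>An infinite packing number would make the factor nonpositive, contradicting
        \<open>half\<close>.\<close>
      then show ?thesis using bound_infinite[OF \<epsilon>] half by simp
    qed
  qed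
  ultimately show ?thesis unfolding K_def by blast
qed

end
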